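(* Let $H$ be a space of real functions on $\mathbb R$ closed under shifts, equipped with the cylindrical $\sigma$-field, and let $\mathcal I$ be the set of compact non-degenerate intervals of $\mathbb R$. A mapping $L:H\times\mathcal I\to\mathbb R\cup\{\infty\}$ is an intrinsic location functional if and only if (1) $L(\cdot,I)$ is measurable for every $I\in\mathcal I$; and (2) for each $f\in H$ there exists a partially ordered subset $(S(f),\preceq_1)$ of $\mathbb R$ such that (a) for any $f\in H$ and $c\in\mathbb R$, $S(f)=S(\theta_cf)+c$; (b) for any $f\in H$, $c\in\mathbb R$ and $t_1,t_2\in S(f)$, $t_1\preceq_1t_2$ implies $t_1-c\preceq_1t_2-c$ in $S(\theta_cf)$; and such that for any $f\in H$ and $I\in\mathcal I$, either $S(f)\cap I=\emptyset$, in which case $L(f,I)=\infty$, or $L(f,I)$ is the maximal element of $S(f)\cap I$ according to $\preceq_1$.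
   Context: For $f\in H$, $c\in\mathbb R$: $\theta_cf(x)=f(x+c)$; closed under shifts means $\theta_cf\in H$. $\mathbb R\cup\{\infty\}$ carries the $\sigma$-field generated by the Borel sets of $\mathbb R$ and $\{\infty\}$; $\infty+c=\infty$. Intrinsic location functional: a map $L:H\times\mathcal I\to\mathbb R\cup\{\infty\}$ such that (1) for every $I\in\mathcal I$, $L(\cdot,I)$ is measurable; (2) $L(f,I)\in I\cup\{\infty\}$ for all $f\in H$, $I\in\mathcal I$; (3) $L(f,I)=L(\theta_cf,I-c)+c$ for all $f\in H$, $I\in\mathcal I$, $c\in\mathbb R$; (4) for $f\in H$ and $I_2\subseteq I_1$ in $\mathcal I$, if $L(f,I_1)\in I_2$ then $L(f,I_2)=L(f,I_1)$; (5) for $f\in H$ and $I_2\subseteq I_1$ in $\mathcal I$, if $L(f,I_2)\ne\infty$ then $L(f,I_1)\neq\infty$. "The maximal element" of $S(f)\cap I$ according to $\preceq_1$ means the element $m$ of this set with $s\preceq_1 m$ for all $s\in S(f)\cap I$. *)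

theory Defs
  imports "HOL-Analysis.Analysis"
begin

definition shift :: "real \<Rightarrow> (real \<Rightarrow> real) \<Rightarrow> real \<Rightarrow> real" where
  "shift c f = (\<lambda>x. f (x + c))"

definition shift_closed :: "(real \<Rightarrow> real) set \<Rightarrow> bool" where
  "shift_closed H \<longleftrightarrow> (\<forall>f\<in>H. \<forall>c. shift c f \<in> H)"

definition compact_intervals :: "real set set" where
  "compact_intervals = {{a..b} | a b. a < b}"

definition cylindrical :: "(real \<Rightarrow> real) set \<Rightarrow> (real \<Rightarrow> real) measure" where
  "cylindrical H = restrict_space (\<Pi>\<^sub>M t\<in>UNIV. borel) H"

text \<open>
  The set of reals together with \<open>\<infinity>\<close> is the subset \<open>real_inf\<close> of
  \<^typ>\<open>ereal\<close>, which leaves out \<open>-\<infinity>\<close>.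
\<close>

definition real_inf :: "ereal set" where
  "real_inf = range ereal \<union> {\<infinity>}"

definition real_inf_borel :: "ereal measure" where
  "real_inf_borel = sigma real_inf ({ereal ` B | B. B \<in> sets borel} \<union> {{\<infinity>}})"

text \<open>
  A map on \<open>H \<times> compact_intervals\<close> is represented by a total function, whose values
  outside this domain are never referred to.
\<close>

definition intrinsic_location_functional ::
    "(real \<Rightarrow> real) set \<Rightarrow> ((real \<Rightarrow> real) \<Rightarrow> real set \<Rightarrow> ereal) \<Rightarrow> bool" where
  "intrinsic_location_functional H L \<longleftrightarrow>
     (\<forall>f\<in>H. \<forall>I\<in>compact_intervals. L f I \<in> real_inf) \<and>
     (\<forall>I\<in>compact_intervals. (\<lambda>f. L f I) \<in> cylindrical H \<rightarrow>\<^sub>M real_inf_borel) \<and>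
     (\<forall>f\<in>H. \<forall>I\<in>compact_intervals. L f I \<in> ereal ` I \<union> {\<infinity>}) \<and>
     (\<forall>f\<in>H. \<forall>I\<in>compact_intervals. \<forall>c.
        L f I = L (shift c f) ((\<lambda>x. x - c) ` I) + ereal c) \<and>
     (\<forall>f\<in>H. \<forall>I\<^sub>1\<in>compact_intervals. \<forall>I\<^sub>2\<in>compact_intervals.
        I\<^sub>2 \<subseteq> I\<^sub>1 \<longrightarrow> L f I\<^sub>1 \<in> ereal ` I\<^sub>2 \<longrightarrow> L f I\<^sub>2 = L f I\<^sub>1) \<and>
     (\<forall>f\<in>H. \<forall>I\<^sub>1\<in>compact_intervals. \<forall>I\<^sub>2\<in>compact_intervals.
        I\<^sub>2 \<subseteq> I\<^sub>1 \<longrightarrow> L f I\<^sub>2 \<noteq> \<infinity> \<longrightarrow> L f I\<^sub>1 \<noteq> \<infinity>)"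

text \<open>
  The element of \<open>A\<close> that lies above all the others: \<open>r\<close> need not be total, so this is
  stronger than having no element of \<open>A\<close> strictly above it.
\<close>

definition maximal_element :: "real rel \<Rightarrow> real set \<Rightarrow> real \<Rightarrow> bool" where
  "maximal_element r A m \<longleftrightarrow> m \<in> A \<and> (\<forall>s\<in>A. (s, m) \<in> r)"

end

theory Submission
  imports Defs
begin

text \<open>
  For the forward direction, \<open>S f\<close> is the set of finite values of \<open>L f\<close>, and
  \<open>s\<close> lies below \<open>t\<close> if \<open>t\<close> is the value on some interval containing \<open>s\<close>.
  Everything rests on one observation: if \<open>I\<close> and \<open>J\<close> meet and \<open>L f J\<close> is finite, then
  \<open>L f (I \<union> J)\<close> is finite, lies in \<open>I\<close> or in \<open>J\<close>, and is then the value on that interval.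
\<close>

section \<open>Compact intervals and greatest elements\<close>

lemma compact_intervals_Un:
  assumes "I \<in> compact_intervals" "J \<in> compact_intervals" "I \<inter> J \<noteq> {}"
  shows "I \<union> J \<in> compact_intervals"
proof -
  obtain a b where I: "I = {a..b}" "a < b"
    using assms(1) by (auto simp: compact_intervals_def)
  obtain c d where J: "J = {c..d}" "c < d"
    using assms(2) by (auto simp: compact_intervals_def)
  have "I \<union> J = {min a c..max b d}"
    using assms(3) I J by auto
  moreover have "min a c < max b d"
    using I J by auto
  ultimately show ?thesis
    by (auto simp: compact_intervals_def)
qed

text \<open>Antisymmetry of the order compares two intervals on a common subinterval. The hull of
  the two points serves, and it is non-degenerate because they differ.\<close>

lemma compact_intervals_hull:
  assumes "s \<noteq> t"
  shows "{min s t..max s t} \<in> compact_intervals"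
proof -
  have "min s t < max s t"
    using assms by (auto simp: min_def max_def)
  then show ?thesis
    by (auto simp: compact_intervals_def)
qed

lemma compact_intervals_hull_subset:
  assumes "I \<in> compact_intervals" "s \<in> I" "t \<in> I"
  shows "{min s t..max s t} \<subseteq> I"
  using assms by (auto simp: compact_intervals_def)

lemma compact_intervals_translate:
  assumes "I \<in> compact_intervals"
  shows "(\<lambda>x. x - c) ` I \<in> compact_intervals"
proof -
  obtain a b where I: "I = {a..b}" "a < b"
    using assms by (auto simp: compact_intervals_def)
  have "(\<lambda>x. x - c) ` I = {a - c..b - c}"
    using I by simp
  then show ?thesis
    using I by (auto simp: compact_intervals_def)
qed

lemma maximal_element_unique:
  assumes "antisym r" "maximal_element r A m" "maximal_element r A n"
  shows "m = n"
  using assms by (auto simp: maximal_element_def dest: antisymD)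

lemma maximal_element_subset:
  assumes "maximal_element r A m" "B \<subseteq> A" "m \<in> B"
  shows "maximal_element r B m"
  using assms by (auto simp: maximal_element_def)

section \<open>The order attached to a single function\<close>

definition location_values :: "(real set \<Rightarrow> ereal) \<Rightarrow> real set" where
  "location_values l = {t. \<exists>I\<in>compact_intervals. l I = ereal t}"

text \<open>A point of \<open>I\<close> need not be a value on any interval, so \<open>s\<close> is
  explicitly confined to the carrier; \<open>t\<close> lies in it as the value on
  \<open>I\<close>.\<close>

definition location_order :: "(real set \<Rightarrow> ereal) \<Rightarrow> real rel" where
  "location_order l =
     {(s, t). s \<in> location_values l \<and> (\<exists>I\<in>compact_intervals. s \<in> I \<and> l I = ereal t)}"

text \<open>These are the conditions that concern one fixed function, with \<open>l\<close> standing
  for \<open>L f\<close>; the order is built from them alone.\<close>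

locale interval_location =
  fixes l :: "real set \<Rightarrow> ereal"
  assumes mem: "I \<in> compact_intervals \<Longrightarrow> l I \<in> ereal ` I \<union> {\<infinity>}"
    and restrict: "\<lbrakk>I \<in> compact_intervals; J \<in> compact_intervals; J \<subseteq> I; l I \<in> ereal ` J\<rbrakk>
      \<Longrightarrow> l J = l I"
    and extend: "\<lbrakk>I \<in> compact_intervals; J \<in> compact_intervals; J \<subseteq> I; l J \<noteq> \<infinity>\<rbrakk>
      \<Longrightarrow> l I \<noteq> \<infinity>"
begin

lemma value_mem:
  assumes "I \<in> compact_intervals" "l I = ereal t"
  shows "t \<in> I"
  using mem[OF assms(1)] assms(2) by auto

text \<open>The value \<open>v\<close> on the union lies in \<open>I\<close> in either case: if it
  lies in \<open>J\<close>, restriction to \<open>J\<close> makes it equal to \<open>s\<close>,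
  which is in \<open>I\<close>. Restriction to \<open>I\<close> then gives the value there.\<close>

lemma value_Un:
  assumes I: "I \<in> compact_intervals" and J: "J \<in> compact_intervals"
    and s: "s \<in> I" and l: "l J = ereal s"
  obtains v where "v \<in> I" "l (I \<union> J) = ereal v" "l I = ereal v"
proof -
  have sJ: "s \<in> J"
    using value_mem[OF J l] .
  have K: "I \<union> J \<in> compact_intervals"
    using compact_intervals_Un[OF I J] s sJ by blast
  have "l (I \<union> J) \<noteq> \<infinity>"
    using extend[OF K J] l by simp
  then obtain v where v: "v \<in> I \<union> J" "l (I \<union> J) = ereal v"
    using mem[OF K] by auto
  have "v \<in> I"
  proof (cases "v \<in> J")
    case True
    then have "l J = ereal v"
      using restrict[OF K J] v by simp
    then show ?thesis
      using l s by simp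
  qed (use v in auto)
  then show thesis
    using that v restrict[OF K I] by simp
qed

lemma location_order_partial_order:
  "partial_order_on (location_values l) (location_order l)"
proof -
  have "location_order l \<subseteq> location_values l \<times> location_values l"
    by (auto simp: location_order_def location_values_def)
  \<comment> \<open>An interval on which \<open>t\<close> is the value contains \<open>t\<close>, so
    it witnesses that \<open>t\<close> is below itself.\<close>
  moreover have "refl_on (location_values l) (location_order l)"
    using value_mem by (fastforce simp: refl_on_def location_order_def location_values_def)
  moreover have "trans (location_order l)"
  proof (rule transI)
    fix s t u
    assume st: "(s, t) \<in> location_order l" and tu: "(t, u) \<in> location_order l"
    from st obtain I where I: "I \<in> compact_intervals" "s \<in> I" "l I = ereal t"
      by (auto simp: location_order_def)
    from tu obtain J where J: "J \<in> compact_intervals" "t \<in> J" "l J = ereal u"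
      by (auto simp: location_order_def)
    \<comment> \<open>The value \<open>t\<close> on \<open>I\<close> lies in \<open>J\<close>, so
      the union takes the value of \<open>J\<close>; since it also contains \<open>s\<close>, it is
      the witness for \<open>(s, u)\<close>.\<close>
    have "l (J \<union> I) = ereal u"
      using value_Un[OF J(1) I(1) J(2) I(3)] J(3) by metis
    moreover have "J \<union> I \<in> compact_intervals"
      using compact_intervals_Un[OF J(1) I(1)] J(2) value_mem[OF I(1,3)] by blast
    ultimately show "(s, u) \<in> location_order l"
      using st I(2) by (auto simp: location_order_def)
  qed
  moreover have "antisym (location_order l)"
  proof (rule antisymI, rule ccontr)
    fix s t
    assume st: "(s, t) \<in> location_order l" and ts: "(t, s) \<in> location_order l" and "s \<noteq> t"
    \<comment> \<open>\<open>K\<close> lies in both witnessing intervals and contains both of their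
      values, so restriction forces \<open>l K\<close> to be \<open>t\<close> as well as
      \<open>s\<close>.\<close>
    define K where "K = {min s t..max s t}"
    have K: "K \<in> compact_intervals"
      using compact_intervals_hull[OF \<open>s \<noteq> t\<close>] by (simp add: K_def)
    have mem_K: "s \<in> K" "t \<in> K"
      by (auto simp: K_def)
    from st obtain I where I: "I \<in> compact_intervals" "s \<in> I" "l I = ereal t"
      by (auto simp: location_order_def)
    from ts obtain J where J: "J \<in> compact_intervals" "t \<in> J" "l J = ereal s"
      by (auto simp: location_order_def)
    have "K \<subseteq> I" "K \<subseteq> J"
      unfolding K_def
      using compact_intervals_hull_subset[OF I(1,2) value_mem[OF I(1,3)]]
        compact_intervals_hull_subset[OF J(1) value_mem[OF J(1,3)] J(2)]
      by auto
    then have "l K = ereal t" "l K = ereal s"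
      using restrict[OF I(1) K] restrict[OF J(1) K] I(3) J(3) mem_K by auto
    then show False
      using \<open>s \<noteq> t\<close> by simp
  qed
  ultimately show ?thesis
    by (simp add: partial_order_on_def preorder_on_def)
qed

text \<open>If \<open>l I\<close> is infinite, a value in \<open>I\<close> would contradict
  \<open>value_Un\<close>. If it is finite, \<open>I\<close> itself witnesses that every value in
  \<open>I\<close> lies below it.\<close>

lemma location_maximal:
  assumes I: "I \<in> compact_intervals"
  shows "(location_values l \<inter> I = {} \<and> l I = \<infinity>) \<or>
    (\<exists>m. maximal_element (location_order l) (location_values l \<inter> I) m \<and> l I = ereal m)"
proof (cases "l I = \<infinity>")
  case True
  have "s \<notin> I" if "s \<in> location_values l" for s
    using that value_Un[OF I] True by (force simp: location_values_def)
  then show ?thesis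
    using True by blast
next
  case False
  then obtain m where "m \<in> I" "l I = ereal m"
    using mem[OF I] by auto
  then show ?thesis
    using I by (auto simp: maximal_element_def location_order_def location_values_def)
qed

end

section \<open>Behaviour of values and order under shifts\<close>

lemma intrinsic_location_functional_interval_location:
  assumes "intrinsic_location_functional H L" "f \<in> H"
  shows "interval_location (L f)"
proof
  fix I J :: "real set"
  assume I: "I \<in> compact_intervals"
  show "L f I \<in> ereal ` I \<union> {\<infinity>}"
    using assms I unfolding intrinsic_location_functional_def by metis
  assume J: "J \<in> compact_intervals" "J \<subseteq> I"
  show "L f J = L f I" if "L f I \<in> ereal ` J"
    using assms I J that unfolding intrinsic_location_functional_def by metis
  show "L f I \<noteq> \<infinity>" if "L f J \<noteq> \<infinity>"
    using assms I J that unfolding intrinsic_location_functional_def by metis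
qed

lemma intrinsic_location_functional_shift:
  assumes "intrinsic_location_functional H L" "f \<in> H" "I \<in> compact_intervals"
    and "L f I = ereal t"
  shows "L (shift c f) ((\<lambda>x. x - c) ` I) = ereal (t - c)"
proof -
  have "ereal t = L (shift c f) ((\<lambda>x. x - c) ` I) + ereal c"
    using assms unfolding intrinsic_location_functional_def by metis
  \<comment> \<open>Subtracting \<open>c\<close> is legitimate only for a finite value; the cases
    \<plusminus>\<infinity> are excluded because the sum is the real number
    \<open>t\<close>.\<close>
  then show ?thesis
    by (cases "L (shift c f) ((\<lambda>x. x - c) ` I)") auto
qed

lemma location_values_shift:
  assumes "intrinsic_location_functional H L" "f \<in> H" "t \<in> location_values (L f)"
  shows "t - c \<in> location_values (L (shift c f))"
  using assms(3) intrinsic_location_functional_shift[OF assms(1,2)] compact_intervals_translate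
  unfolding location_values_def by blast

lemma location_order_shift:
  assumes "intrinsic_location_functional H L" "f \<in> H" "(s, t) \<in> location_order (L f)"
  shows "(s - c, t - c) \<in> location_order (L (shift c f))"
proof -
  obtain I where I: "I \<in> compact_intervals" "s \<in> I" "L f I = ereal t"
    and s: "s \<in> location_values (L f)"
    using assms(3) by (auto simp: location_order_def)
  have "\<exists>J\<in>compact_intervals. s - c \<in> J \<and> L (shift c f) J = ereal (t - c)"
  proof (intro bexI conjI)
    show "s - c \<in> (\<lambda>x. x - c) ` I"
      using I(2) by simp
    show "L (shift c f) ((\<lambda>x. x - c) ` I) = ereal (t - c)"
      using intrinsic_location_functional_shift[OF assms(1,2), OF I(1,3), of c] .
    show "(\<lambda>x. x - c) ` I \<in> compact_intervals"
      using compact_intervals_translate[OF I(1), of c] .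
  qed
  then show ?thesis
    using location_values_shift[OF assms(1,2), OF s, of c] by (simp add: location_order_def)
qed

lemma shift_shift_cancel [simp]: "shift (- c) (shift c f) = f"
  by (simp add: shift_def)

text \<open>The second inclusion is \<open>location_values_shift\<close> applied to
  \<open>shift c f\<close> and \<open>- c\<close>; closure of \<open>H\<close> under shifts makes
  this instance available.\<close>

lemma location_values_shift_eq:
  assumes L: "intrinsic_location_functional H L" and "shift_closed H" and f: "f \<in> H"
  shows "location_values (L f) = (\<lambda>s. s + c) ` location_values (L (shift c f))"
proof (intro equalityI subsetI)
  fix t assume "t \<in> location_values (L f)"
  then have "t - c \<in> location_values (L (shift c f))"
    using location_values_shift[OF L f] by blast
  then show "t \<in> (\<lambda>s. s + c) ` location_values (L (shift c f))"
    by (rule rev_image_eqI) simp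
next
  have "shift c f \<in> H"
    using assms by (simp add: shift_closed_def)
  then show "t \<in> location_values (L f)"
    if "t \<in> (\<lambda>s. s + c) ` location_values (L (shift c f))" for t
    using that location_values_shift[OF L, of "shift c f" _ "- c"] by auto
qed

section \<open>Equivalence with shift-compatible partial orders\<close>

theorem corollary3p7:
  fixes H :: "(real \<Rightarrow> real) set"
    and L :: "(real \<Rightarrow> real) \<Rightarrow> real set \<Rightarrow> ereal"
  assumes "shift_closed H"
    and "\<And>f I. f \<in> H \<Longrightarrow> I \<in> compact_intervals \<Longrightarrow> L f I \<in> real_inf"
  shows "intrinsic_location_functional H L \<longleftrightarrow>
    (\<forall>I\<in>compact_intervals. (\<lambda>f. L f I) \<in> cylindrical H \<rightarrow>\<^sub>M real_inf_borel) \<and>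
    (\<exists>(S :: (real \<Rightarrow> real) \<Rightarrow> real set) (R :: (real \<Rightarrow> real) \<Rightarrow> real rel).
       (\<forall>f\<in>H. partial_order_on (S f) (R f)) \<and>
       (\<forall>f\<in>H. \<forall>c. S f = (\<lambda>s. s + c) ` S (shift c f)) \<and>
       (\<forall>f\<in>H. \<forall>c. \<forall>t\<^sub>1\<in>S f. \<forall>t\<^sub>2\<in>S f.
          (t\<^sub>1, t\<^sub>2) \<in> R f \<longrightarrow> (t\<^sub>1 - c, t\<^sub>2 - c) \<in> R (shift c f)) \<and>
       (\<forall>f\<in>H. \<forall>I\<in>compact_intervals.
          (S f \<inter> I = {} \<and> L f I = \<infinity>) \<or>
          (\<exists>m. maximal_element (R f) (S f \<inter> I) m \<and> L f I = ereal m)))"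
  (is "_ \<longleftrightarrow> ?meas \<and> ?order")
proof
  assume L: "intrinsic_location_functional H L"
  have "?meas"
    using L by (simp add: intrinsic_location_functional_def)
  moreover have "?order"
  proof (intro exI[of _ "\<lambda>f. location_values (L f)"] exI[of _ "\<lambda>f. location_order (L f)"]
      conjI ballI allI impI)
    fix f assume f: "f \<in> H"
    interpret interval_location "L f"
      using intrinsic_location_functional_interval_location[OF L f] .
    show "partial_order_on (location_values (L f)) (location_order (L f))"
      using location_order_partial_order .
    show "location_values (L f) = (\<lambda>s. s + c) ` location_values (L (shift c f))" for c
      using location_values_shift_eq[OF L assms(1) f] .
    show "(s - c, t - c) \<in> location_order (L (shift c f))"
      if "(s, t) \<in> location_order (L f)" for s t c
      using location_order_shift[OF L f, OF that, of c] .
    show "(location_values (L f) \<inter> I = {} \<and> L f I = \<infinity>) \<or>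
      (\<exists>m. maximal_element (location_order (L f)) (location_values (L f) \<inter> I) m \<and>
        L f I = ereal m)" if "I \<in> compact_intervals" for I
      using location_maximal[OF that] .
  qed
  ultimately show "?meas \<and> ?order" ..
next
  assume "?meas \<and> ?order"
  then obtain S :: "(real \<Rightarrow> real) \<Rightarrow> real set" and R :: "(real \<Rightarrow> real) \<Rightarrow> real rel"
    where meas: ?meas
      and po: "\<forall>f\<in>H. partial_order_on (S f) (R f)"
      and S_shift: "\<forall>f\<in>H. \<forall>c. S f = (\<lambda>s. s + c) ` S (shift c f)"
      and R_shift: "\<forall>f\<in>H. \<forall>c. \<forall>t\<^sub>1\<in>S f. \<forall>t\<^sub>2\<in>S f.
        (t\<^sub>1, t\<^sub>2) \<in> R f \<longrightarrow> (t\<^sub>1 - c, t\<^sub>2 - c) \<in> R (shift c f)"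
      and max: "\<forall>f\<in>H. \<forall>I\<in>compact_intervals. (S f \<inter> I = {} \<and> L f I = \<infinity>) \<or>
        (\<exists>m. maximal_element (R f) (S f \<inter> I) m \<and> L f I = ereal m)"
    by (elim conjE exE) (rule that)
  note po = po[rule_format] and S_shift = S_shift[rule_format]
    and R_shift = R_shift[rule_format] and max = max[rule_format]
  \<comment> \<open>Antisymmetry makes the greatest element unique, so exhibiting one determines
    \<open>L f I\<close>. The shift and restriction conditions are both obtained this way.\<close>
  have L_eqI: "L f I = ereal m"
    if f: "f \<in> H" and I: "I \<in> compact_intervals"
      and m: "maximal_element (R f) (S f \<inter> I) m" for f I m
  proof -
    have "m \<in> S f \<inter> I"
      using m by (simp add: maximal_element_def)
    then obtain n where n: "maximal_element (R f) (S f \<inter> I) n" "L f I = ereal n"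
      using max[OF f I] by blast
    have "antisym (R f)"
      using po[OF f] by (simp add: partial_order_on_def)
    then show ?thesis
      using maximal_element_unique[OF _ m n(1)] n(2) by simp
  qed
  have mem: "L f I \<in> ereal ` I \<union> {\<infinity>}" if "f \<in> H" "I \<in> compact_intervals" for f I
    using max[OF that] by (auto simp: maximal_element_def)
  \<comment> \<open>Finiteness becomes non-emptiness of \<open>S f \<inter> I\<close>, which passes
    to larger intervals; this is the extension condition.\<close>
  have infinite_iff: "L f I = \<infinity> \<longleftrightarrow> S f \<inter> I = {}" if "f \<in> H" "I \<in> compact_intervals" for f I
    using max[OF that] by (auto simp: maximal_element_def)
  have shift: "L f I = L (shift c f) ((\<lambda>x. x - c) ` I) + ereal c"
    if f: "f \<in> H" and I: "I \<in> compact_intervals" for f I c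
  proof -
    have g: "shift c f \<in> H"
      using assms(1) f by (simp add: shift_closed_def)
    have J: "(\<lambda>x. x - c) ` I \<in> compact_intervals"
      using compact_intervals_translate[OF I] .
    have inter: "S (shift c f) \<inter> (\<lambda>x. x - c) ` I = (\<lambda>x. x - c) ` (S f \<inter> I)"
      using S_shift[OF f, of c] by force
    from max[OF f I] show ?thesis
    proof (elim disjE exE conjE)
      \<comment> \<open>The translated intersection is empty too, and \<infinity> + c =
        \<infinity>.\<close>
      assume "S f \<inter> I = {}" "L f I = \<infinity>"
      then show ?thesis
        using infinite_iff[OF g J] inter by simp
    next
      fix m assume m: "maximal_element (R f) (S f \<inter> I) m" "L f I = ereal m"
      \<comment> \<open>Translation carries every relation \<open>(s, m)\<close> to
        \<open>(s - c, m - c)\<close>, so it carries the greatest element along.\<close>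
      then have "maximal_element (R (shift c f)) ((\<lambda>x. x - c) ` (S f \<inter> I)) (m - c)"
        using R_shift[OF f] by (auto simp: maximal_element_def)
      then show ?thesis
        using L_eqI[OF g J] inter m(2) by simp
    qed
  qed
  have restrict: "L f J = L f I"
    if f: "f \<in> H" and I: "I \<in> compact_intervals" and J: "J \<in> compact_intervals"
      and sub: "J \<subseteq> I" and v: "L f I \<in> ereal ` J" for f I J
  proof -
    obtain m where m: "maximal_element (R f) (S f \<inter> I) m" "L f I = ereal m"
      using max[OF f I] v by auto
    \<comment> \<open>By \<open>v\<close> the point \<open>m\<close> lies in \<open>J\<close>, and a
      greatest element stays greatest in a subset that contains it.\<close>
    have "maximal_element (R f) (S f \<inter> J) m"
      using maximal_element_subset[OF m(1), of "S f \<inter> J"] m sub v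
      by (auto simp: maximal_element_def)
    then show ?thesis
      using L_eqI[OF f J] m(2) by simp
  qed
  have extend: "L f I \<noteq> \<infinity>"
    if "f \<in> H" "I \<in> compact_intervals" "J \<in> compact_intervals" "J \<subseteq> I" "L f J \<noteq> \<infinity>" for f I J
    using that infinite_iff by blast
  show "intrinsic_location_functional H L"
    unfolding intrinsic_location_functional_def
    using assms(2) meas mem shift restrict extend by (intro conjI) blast+
qed

end
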